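(* Let $\{x_k\},\{v_k\}$ be generated by the niAPG algorithm with exact proximal steps, i.e. $x_{k+1}=\mathrm{prox}_{\eta g}(z_k)$ for every $k\ge1$. Let $\phi(k)=\arg\min_{t=\max(k-q,1),\dots,k}\|x_{t+1}-v_t\|_2^2$ and $c_1=\max_{t=1,\dots,q+1}F(x_t)-\inf F$. Then (i) $\lim_{k\to\infty}\|\mathcal{G}(v_{\phi(k)})\|_2^2=0$; and (ii) for every $K\ge1$, $\displaystyle\min_{k=1,\dots,K}\|\mathcal{G}(v_{\phi(k)})\|_2^2\le\frac{2(q+1)c_1}{(\rho-L)K}$.
   Context: Setting: $F=f+g$ on $\mathbb{R}^d$, where $f:\mathbb{R}^d\to\mathbb{R}$ is differentiable and $L$-Lipschitz smooth ($\|\nabla f(x)-\nabla f(y)\|_2\le L\|x-y\|_2$ for all $x,y$), $g:\mathbb{R}^d\to(-\infty,+\infty]$ is proper and lower semicontinuous, $F$ is bounded from below, and $F(x)\to\infty$ as $\|x\|_2\to\infty$. Both $f$ and $g$ may be nonconvex. The proximal step is $\mathrm{prox}_{\eta g}(z)=\arg\min_x \frac12\|x-z\|_2^2+\eta g(x)$ (if the minimizer is not unique, a single-valued choice of minimizer, the same one in the algorithm and in $\mathcal{G}$). The proximal mapping is $\mathcal{G}(v)=v-\mathrm{prox}_{\eta g}(v-\eta\nabla f(v))$. niAPG algorithm: choose $\eta\in(0,1/L)$, $\delta\in(0,\frac1\eta-L)$, and an integer $q\ge 0$; put $\rho=1/\eta$ and $x_0=x_1=0$. For $k=1,2,\dots$: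 $y_k=x_k+\frac{k-1}{k+2}(x_k-x_{k-1})$; $\Delta_k=\max_{t=\max(1,k-q),\dots,k}F(x_t)$; $v_k=y_k$ if $F(y_k)\le\Delta_k$, and $v_k=x_k$ otherwise; $z_k=v_k-\eta\nabla f(v_k)$; $x_{k+1}=\mathrm{prox}_{\eta g}(z_k)$ (possibly computed inexactly). *)

theory Defs
  imports "HOL-Analysis.Analysis"
begin

definition proper :: "('a \<Rightarrow> ereal) \<Rightarrow> bool" where
  "proper g \<longleftrightarrow> (\<forall>x. g x \<noteq> -\<infinity>) \<and> (\<exists>x. g x \<noteq> \<infinity>)"

definition lower_semicontinuous :: "('a::topological_space \<Rightarrow> ereal) \<Rightarrow> bool" where
  "lower_semicontinuous g \<longleftrightarrow> (\<forall>x. g x \<le> Liminf (at x) g)"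

definition objective :: "('a \<Rightarrow> real) \<Rightarrow> ('a \<Rightarrow> ereal) \<Rightarrow> 'a \<Rightarrow> ereal" where
  "objective f g x = ereal (f x) + g x"

(* Since g need not be convex, the minimizer may fail to be unique: a proximal operator is any
   single-valued selection of minimizers. *)
definition is_prox :: "real \<Rightarrow> ('a::real_inner \<Rightarrow> ereal) \<Rightarrow> ('a \<Rightarrow> 'a) \<Rightarrow> bool" where
  "is_prox \<eta> g P \<longleftrightarrow>
     (\<forall>z. is_arg_min (\<lambda>x. ereal (1/2 * (norm (x - z))\<^sup>2) + ereal \<eta> * g x) (\<lambda>_. True) (P z))"

definition prox_mapping :: "real \<Rightarrow> ('a::real_inner \<Rightarrow> 'a) \<Rightarrow> ('a \<Rightarrow> 'a) \<Rightarrow> 'a \<Rightarrow> 'a" where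
  "prox_mapping \<eta> grad_f P v = v - P (v - \<eta> *\<^sub>R grad_f v)"

(* The window of the last q + 1 indices, cut off below at 1; truncated subtraction on nat is
   harmless because of the maximum with 1. *)
definition window :: "nat \<Rightarrow> nat \<Rightarrow> nat set" where
  "window q k = {max 1 (k - q)..k}"

definition max_recent :: "('a \<Rightarrow> ereal) \<Rightarrow> nat \<Rightarrow> (nat \<Rightarrow> 'a) \<Rightarrow> nat \<Rightarrow> ereal" where
  "max_recent F q x k = Max ((\<lambda>t. F (x t)) ` window q k)"

(* The sequences y, v, z are constrained only at indices k >= 1. *)
definition niAPG ::
  "('a::real_inner \<Rightarrow> real) \<Rightarrow> ('a \<Rightarrow> 'a) \<Rightarrow> ('a \<Rightarrow> ereal) \<Rightarrow> real \<Rightarrow> ('a \<Rightarrow> 'a) \<Rightarrow> nat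
    \<Rightarrow> (nat \<Rightarrow> 'a) \<Rightarrow> (nat \<Rightarrow> 'a) \<Rightarrow> (nat \<Rightarrow> 'a) \<Rightarrow> (nat \<Rightarrow> 'a) \<Rightarrow> bool" where
  "niAPG f grad_f g \<eta> P q x y v z \<longleftrightarrow>
     x 0 = 0 \<and> x 1 = 0 \<and>
     (\<forall>k\<ge>1.
        y k = x k + ((real k - 1) / (real k + 2)) *\<^sub>R (x k - x (k - 1)) \<and>
        v k = (if objective f g (y k) \<le> max_recent (objective f g) q x k then y k else x k) \<and>
        z k = v k - \<eta> *\<^sub>R grad_f (v k) \<and>
        x (k + 1) = P (z k))"

end

(* The prox inequality and the descent lemma for f give
     F (x (k + 1)) + (1/\<eta> - L)/2 * |x (k + 1) - v k|^2 \<le> F (v k),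
   and F (v k) is at most the maximum of F (x t) over the window at k. Hence every value F (x (k + 1))
   lies below some earlier value in the window, by a margin proportional to the k-th squared step.
   For the rate, bound all margins below by their minimum e: since one step back in this relation
   goes back at most q + 1 indices, the values decrease at least linearly with slope e/(q + 1).
   For the limit, the window maxima are eventually finite, nonincreasing and bounded below, and
   over q + 1 consecutive indices they drop by at least the smallest margin in the window. *)
theory Submission
  imports Defs
begin

text \<open>Proved by monotonicity along the segment from \<open>v\<close> to \<open>p\<close>: the
  gap \<open>\<psi>\<close> between \<open>f\<close> and its quadratic model has slope
  \<open>(grad_f (v + t *\<^sub>R h) - grad_f v) \<bullet> h - L * t * (norm h)\<^sup>2\<close>,
  which Cauchy-Schwarz and the Lipschitz bound make nonpositive.\<close>

lemma Lipschitz_gradient_upper_bound: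
  fixes f :: "'a::real_inner \<Rightarrow> real"
  assumes grad: "\<And>u. GDERIV f u :> grad_f u" and lip: "L-lipschitz_on UNIV grad_f"
  shows "f p \<le> f v + grad_f v \<bullet> (p - v) + L / 2 * (norm (p - v))\<^sup>2"
proof -
  define h where "h = p - v"
  define \<psi> where "\<psi> t = f (v + t *\<^sub>R h) - t * (grad_f v \<bullet> h) - L / 2 * t\<^sup>2 * (norm h)\<^sup>2" for t
  have "\<psi> 1 \<le> \<psi> 0"
  proof (rule DERIV_nonpos_imp_nonincreasing[where a = 0 and b = 1])
    fix t :: real
    assume t: "0 \<le> t" "t \<le> 1"
    have "((\<lambda>t. v + t *\<^sub>R h) has_derivative (\<lambda>s. s *\<^sub>R h)) (at t)"
      by (auto intro!: derivative_eq_intros)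
    moreover have "(f has_derivative (\<lambda>w. w \<bullet> grad_f (v + t *\<^sub>R h))) (at (v + t *\<^sub>R h))"
      using grad by (simp add: gderiv_def)
    ultimately have
      "((\<lambda>t. f (v + t *\<^sub>R h)) has_derivative (\<lambda>s. (s *\<^sub>R h) \<bullet> grad_f (v + t *\<^sub>R h))) (at t)"
      by (rule has_derivative_compose)
    then have "((\<lambda>t. f (v + t *\<^sub>R h)) has_real_derivative (grad_f (v + t *\<^sub>R h) \<bullet> h)) (at t)"
      by (simp add: has_field_derivative_def mult.commute inner_commute[of h] mult_commute_abs)
    then have der: "(\<psi> has_real_derivative
        (grad_f (v + t *\<^sub>R h) \<bullet> h - grad_f v \<bullet> h - L * t * (norm h)\<^sup>2)) (at t)"
      unfolding \<psi>_def by (auto intro!: derivative_eq_intros)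
    have "(grad_f (v + t *\<^sub>R h) - grad_f v) \<bullet> h \<le> norm (grad_f (v + t *\<^sub>R h) - grad_f v) * norm h"
      by (rule norm_cauchy_schwarz)
    also have "\<dots> \<le> L * norm (t *\<^sub>R h) * norm h"
      using lipschitz_onD[OF lip, of "v + t *\<^sub>R h" v]
      by (intro mult_right_mono) (auto simp: dist_norm)
    also have "\<dots> = L * t * (norm h)\<^sup>2"
      using t by (simp add: power2_eq_square)
    finally show "\<exists>y. DERIV \<psi> t :> y \<and> y \<le> 0"
      using der by (auto simp: inner_diff_left)
  qed simp
  then show ?thesis
    by (simp add: \<psi>_def h_def)
qed

lemma is_prox_le:
  assumes "is_prox \<eta> g P"
  shows "ereal (1/2 * (norm (P z - z))\<^sup>2) + ereal \<eta> * g (P z)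
    \<le> ereal (1/2 * (norm (u - z))\<^sup>2) + ereal \<eta> * g u"
  using assms by (auto simp: is_prox_def is_arg_min_def not_less)

text \<open>A point where \<open>g\<close> is finite gives a finite competitor, so the minimum is
  finite. This later makes every iterate produced by a proximal step have a finite objective
  value.\<close>

lemma is_prox_finite:
  assumes prox: "is_prox \<eta> g P" and "proper g" and "0 < \<eta>"
  shows "\<bar>g (P z)\<bar> \<noteq> \<infinity>"
proof -
  obtain u where u: "\<bar>g u\<bar> \<noteq> \<infinity>"
    using \<open>proper g\<close> by (auto simp: proper_def)
  have "g (P z) \<noteq> -\<infinity>"
    using \<open>proper g\<close> by (simp add: proper_def)
  moreover have "g (P z) \<noteq> \<infinity>"
    using is_prox_le[OF prox, of z u] u \<open>0 < \<eta>\<close> by auto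
  ultimately show ?thesis by auto
qed

lemma prox_gradient_step_descent:
  fixes f :: "'a::real_inner \<Rightarrow> real"
  assumes grad: "\<And>u. GDERIV f u :> grad_f u" and lip: "L-lipschitz_on UNIV grad_f"
    and proper: "proper g" and "0 < \<eta>" and prox: "is_prox \<eta> g P"
    and p: "p = P (v - \<eta> *\<^sub>R grad_f v)"
  shows "objective f g p + ereal ((1 / \<eta> - L) / 2 * (norm (p - v))\<^sup>2) \<le> objective f g v"
proof (cases "g v")
  case (real r)
  obtain s where s: "g p = ereal s"
    using is_prox_finite[OF prox proper \<open>0 < \<eta>\<close>] unfolding p by (auto simp: ereal_infinity_cases)
  \<comment> \<open>Minimality of \<open>p\<close> is tested against \<open>v\<close> itself.
    Expanding the square cancels the pure gradient terms, and dividing by \<open>\<eta>\<close>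
    leaves the linear term of the quadratic model of \<open>f\<close>.\<close>
  have "1/2 * (norm ((p - v) + \<eta> *\<^sub>R grad_f v))\<^sup>2 + \<eta> * s \<le> 1/2 * (norm (\<eta> *\<^sub>R grad_f v))\<^sup>2 + \<eta> * r"
    using is_prox_le[OF prox, of "v - \<eta> *\<^sub>R grad_f v" v, folded p] real s
    by (simp add: algebra_simps)
  then have "(norm (p - v))\<^sup>2 / 2 + \<eta> * (grad_f v \<bullet> (p - v)) + \<eta> * s \<le> \<eta> * r"
    unfolding power2_norm_eq_inner
    by (simp add: inner_add_left inner_add_right inner_commute[of "p - v" "grad_f v"]
        add_divide_distrib distrib_left)
  then have "((norm (p - v))\<^sup>2 / 2 + \<eta> * (grad_f v \<bullet> (p - v)) + \<eta> * s) / \<eta> \<le> \<eta> * r / \<eta>"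
    using \<open>0 < \<eta>\<close> by (intro divide_right_mono) auto
  then have "(norm (p - v))\<^sup>2 / (2 * \<eta>) + grad_f v \<bullet> (p - v) + s \<le> r"
    using \<open>0 < \<eta>\<close> by (simp add: add_divide_distrib)
  with Lipschitz_gradient_upper_bound[OF grad lip, of p v]
  have "f p + s + (1 / \<eta> - L) / 2 * (norm (p - v))\<^sup>2 \<le> f v + r"
    by (simp add: algebra_simps diff_divide_distrib)
  then show ?thesis
    by (simp add: objective_def real s)
next
  case MInf
  then show ?thesis using proper by (auto simp: proper_def)
qed (simp add: objective_def)

lemma finite_window: "finite (window q k)"
  by (simp add: window_def)

lemma mem_window_self: "1 \<le> k \<Longrightarrow> k \<in> window q k"
  by (simp add: window_def)

lemma le_max_recent_obtain:
  assumes "1 \<le> k" and "a \<le> max_recent F q x k"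
  obtains t where "t \<in> window q k" and "a \<le> F (x t)"
proof -
  have "max_recent F q x k \<in> (\<lambda>t. F (x t)) ` window q k"
    unfolding max_recent_def using mem_window_self[OF \<open>1 \<le> k\<close>] finite_window
    by (intro Max_in) auto
  with assms that show ?thesis by auto
qed

text \<open>The induction is strong because the earlier value supplied by \<open>desc\<close> may
  lie anywhere in the window.\<close>

lemma windowed_descent_linear_bound:
  fixes b :: "nat \<Rightarrow> real"
  assumes "0 \<le> e"
    and desc: "\<And>k. 1 \<le> k \<Longrightarrow> k \<le> K \<Longrightarrow> \<exists>t\<in>window q k. b (k + 1) + e \<le> b t"
  shows "n \<le> K \<Longrightarrow> b (n + 1) + e * real n / (real q + 1) \<le> b 1"
proof (induction n rule: less_induct)
  case (less n)
  show ?case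
  proof (cases "n = 0")
    case False
    with desc[of n] less.prems obtain t where t: "t \<in> window q n" "b (n + 1) + e \<le> b t"
      by auto
    \<comment> \<open>The shift \<open>t = s + 1\<close> fits the induction hypothesis at
      \<open>s\<close>; the single margin \<open>e\<close> then pays for the
      \<open>n - s \<le> q + 1\<close> skipped indices at slope \<open>e / (q + 1)\<close>.\<close>
    then obtain s where s: "t = s + 1" "s < n" "n \<le> s + q + 1"
      by (cases t) (auto simp: window_def)
    have "b t + e * real s / (real q + 1) \<le> b 1"
      using less.IH[of s] s less.prems by simp
    moreover have "real n \<le> real s + (real q + 1)"
      using s(3) by linarith
    then have "e * real n / (real q + 1) \<le> e * (real s + (real q + 1)) / (real q + 1)"
      using \<open>0 \<le> e\<close> by (intro divide_right_mono mult_left_mono) auto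
    then have "e * real n / (real q + 1) \<le> e * real s / (real q + 1) + e"
      by (simp add: distrib_left[of e "real s"] add_divide_distrib)
    ultimately show ?thesis using t(2) by linarith
  qed simp
qed

text \<open>Here \<open>d\<close> holds the margins and \<open>w k\<close> is a lower bound for all
  margins in the window at \<open>k\<close>. The threshold \<open>N\<close> allows initial indices,
  where objective values may be infinite, to be skipped.\<close>

lemma windowed_descent_tendsto_0:
  fixes b d w :: "nat \<Rightarrow> real"
  assumes "1 \<le> N"
    and desc: "\<And>k. N \<le> k \<Longrightarrow> \<exists>t\<in>window q k. b (k + 1) + d k \<le> b t"
    and lower: "\<And>k. N \<le> k \<Longrightarrow> m \<le> b k"
    and nonneg: "\<And>k. N \<le> k \<Longrightarrow> 0 \<le> w k"
    and d_nonneg: "\<And>k. 0 \<le> d k"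
    and le: "\<And>k t. N \<le> k \<Longrightarrow> t \<in> window q k \<Longrightarrow> w k \<le> d t"
  shows "w \<longlonglongrightarrow> 0"
proof -
  define D where "D k = Max (b ` window q k)" for k
  have b_le: "b t \<le> D k" if "t \<in> window q k" for t k
    using that unfolding D_def by (auto simp: finite_window)
  have D_le: "D k \<le> c" if "N \<le> k" "\<And>t. t \<in> window q k \<Longrightarrow> b t \<le> c" for k c
    using that mem_window_self[of k q] \<open>1 \<le> N\<close> unfolding D_def
    by (subst Max_le_iff) (auto simp: finite_window)
  have b_Suc: "b (k + 1) + d k \<le> D k" if "N \<le> k" for k
    using desc[OF that] b_le by force
  have D_Suc: "D (k + 1) \<le> D k" if "N \<le> k" for k
  proof (rule D_le)
    fix t assume "t \<in> window q (k + 1)"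
    then consider "t = k + 1" | "t \<in> window q k"
      by (fastforce simp: window_def)
    then show "b t \<le> D k"
      using b_Suc[OF that] d_nonneg[of k] b_le by cases auto
  qed (use that in simp)
  have dec: "decseq (\<lambda>n. D (n + N))"
    using D_Suc by (intro decseq_SucI) simp
  have "m \<le> D (n + N)" for n
    using lower[of "n + N"] b_le[OF mem_window_self[of "n + N"]] \<open>1 \<le> N\<close> by force
  with dec obtain l where "(\<lambda>n. D (n + N)) \<longlonglongrightarrow> l"
    using decseq_convergent by blast
  then have D_lim: "(\<lambda>n. D (n + i)) \<longlonglongrightarrow> l" for i
    using LIMSEQ_offset LIMSEQ_ignore_initial_segment by blast
  \<comment> \<open>The window at \<open>n + N + q + 1\<close> contains only indices after
    \<open>n + N\<close>, namely the successors of the window at \<open>n + N + q\<close>. So each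
    value in it has lost a margin of at least \<open>w (n + (N + q))\<close> from
    \<open>D (n + N)\<close>.\<close>
  have drop: "w (n + (N + q)) \<le> D (n + N) - D (n + (N + q + 1))" for n
  proof -
    have "D (n + (N + q) + 1) \<le> D (n + N) - w (n + (N + q))"
    proof (rule D_le)
      fix t assume "t \<in> window q (n + (N + q) + 1)"
      then obtain s where s: "t = s + 1" "n + N \<le> s" "s \<in> window q (n + (N + q))"
        using \<open>1 \<le> N\<close> by (cases t) (auto simp: window_def)
      have "D s \<le> D (n + N)"
        using decseqD[OF dec, of n "s - N"] s by simp
      with b_Suc[of s] le[OF _ s(3)] s show "b t \<le> D (n + N) - w (n + (N + q))"
        by simp
    qed simp
    then show ?thesis by (simp add: algebra_simps)
  qed
  \<comment> \<open>Both shifts of \<open>D\<close> have the same limit, so the drops vanish and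
    squeeze \<open>w\<close>.\<close>
  have "(\<lambda>n. D (n + N) - D (n + (N + q + 1))) \<longlonglongrightarrow> 0"
    using tendsto_diff[OF D_lim[of N] D_lim[of "N + q + 1"]] by simp
  then have "(\<lambda>n. w (n + (N + q))) \<longlonglongrightarrow> 0"
    by (rule tendsto_sandwich[OF _ _ tendsto_const, rotated 2])
      (use drop nonneg in \<open>auto intro!: always_eventually\<close>)
  then show ?thesis by (rule LIMSEQ_offset)
qed

theorem proposition4p3:
  fixes f :: "real ^ 'n \<Rightarrow> real" and grad_f :: "real ^ 'n \<Rightarrow> real ^ 'n"
    and g :: "real ^ 'n \<Rightarrow> ereal" and F :: "real ^ 'n \<Rightarrow> ereal"
    and P :: "real ^ 'n \<Rightarrow> real ^ 'n"
    and L \<eta> \<delta> \<rho> :: real and q :: nat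
    and x y v z :: "nat \<Rightarrow> real ^ 'n" and \<phi> :: "nat \<Rightarrow> nat" and c\<^sub>1 :: ereal
  assumes "L > 0"
    and "\<And>u. GDERIV f u :> grad_f u"
    and "L-lipschitz_on UNIV grad_f"
    and "proper g" and "lower_semicontinuous g"
    and "F = objective f g"
    and "\<exists>m::real. \<forall>u. ereal m \<le> F u"
    and "(F \<longlongrightarrow> \<infinity>) at_infinity"
    and "0 < \<eta>" and "\<eta> < 1 / L"
    and "0 < \<delta>" and "\<delta> < 1 / \<eta> - L"
    and "\<rho> = 1 / \<eta>"
    and "is_prox \<eta> g P"
    and "niAPG f grad_f g \<eta> P q x y v z"
    and "\<And>k. k \<ge> 1 \<Longrightarrow>
           is_arg_min (\<lambda>t. (norm (x (t + 1) - v t))\<^sup>2) (\<lambda>t. t \<in> window q k) (\<phi> k)"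
    and "c\<^sub>1 = Max ((\<lambda>t. F (x t)) ` {1..q + 1}) - (INF u. F u)"
  shows "(\<lambda>k. (norm (prox_mapping \<eta> grad_f P (v (\<phi> k))))\<^sup>2) \<longlonglongrightarrow> 0
    \<and> (\<forall>K\<ge>1. ereal (Min ((\<lambda>k. (norm (prox_mapping \<eta> grad_f P (v (\<phi> k))))\<^sup>2) ` {1..K}))
          \<le> ereal (2 * (real q + 1)) * c\<^sub>1 / ereal ((\<rho> - L) * real K))"
proof -
  note grad = assms(2) and lip = assms(3) and proper = assms(4) and F = assms(6)
    and prox = assms(14) and alg = assms(15)[unfolded niAPG_def] and \<phi> = assms(16)
  define a where "a = (\<rho> - L) / 2"
  define d where "d k = (norm (x (k + 1) - v k))\<^sup>2" for k
  define G where "G k = (norm (prox_mapping \<eta> grad_f P (v (\<phi> k))))\<^sup>2" for k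
  \<comment> \<open>\<open>real_of_ereal\<close> sends infinite values to 0, so \<open>b\<close> is
    used only where \<open>F_real\<close> certifies finiteness.\<close>
  define b where "b t = real_of_ereal (F (x t))" for t
  have "0 < a"
    using assms(11,12,13) by (simp add: a_def)
  obtain m where m: "\<And>u. ereal m \<le> F u"
    using assms(7) by blast
  have step: "x (k + 1) = P (v k - \<eta> *\<^sub>R grad_f (v k))" if "1 \<le> k" for k
    using alg that by auto
  have \<phi>_window: "\<phi> k \<in> window q k" and d_\<phi>_le: "t \<in> window q k \<Longrightarrow> d (\<phi> k) \<le> d t"
    if "1 \<le> k" for k t
    using \<phi>[OF that] by (auto simp: is_arg_min_def d_def not_less)
  have G_eq: "G k = d (\<phi> k)" if "1 \<le> k" for k
  proof -
    have "1 \<le> \<phi> k"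
      using \<phi>_window[OF that] by (simp add: window_def)
    then show ?thesis
      unfolding G_def d_def prox_mapping_def using step[of "\<phi> k"] by (simp add: norm_minus_commute)
  qed
  have desc: "\<exists>t\<in>window q k. F (x (k + 1)) + ereal (a * d k) \<le> F (x t)" if k: "1 \<le> k" for k
  proof -
    \<comment> \<open>This covers the fallback \<open>v k = x k\<close>; if
      \<open>v k = y k\<close>, the acceptance test is itself the required bound.\<close>
    have "F (x k) \<le> max_recent F q x k"
      unfolding max_recent_def using mem_window_self[OF k] by (auto simp: finite_window)
    then have "F (v k) \<le> max_recent F q x k"
      using alg k by (auto simp: F)
    then obtain t where "t \<in> window q k" "F (v k) \<le> F (x t)"
      by (rule le_max_recent_obtain[OF k])
    moreover have "F (x (k + 1)) + ereal (a * d k) \<le> F (v k)"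
      using prox_gradient_step_descent[OF grad lip proper assms(9) prox step[OF k]]
      by (simp add: F a_def d_def assms(13))
    ultimately show ?thesis by (meson order_trans)
  qed
  \<comment> \<open>From index 2 on the iterates are proximal points; the starting point
    \<open>x 1 = 0\<close> may lie outside the domain of \<open>g\<close>.\<close>
  have F_real: "F (x t) = ereal (b t)" if "2 \<le> t \<or> t = 1 \<and> F (x 1) \<noteq> \<infinity>" for t
  proof (cases "2 \<le> t")
    case True
    have "\<bar>g (P (v (t - 1) - \<eta> *\<^sub>R grad_f (v (t - 1))))\<bar> \<noteq> \<infinity>"
      by (rule is_prox_finite[OF prox proper assms(9)])
    then have "\<bar>g (x t)\<bar> \<noteq> \<infinity>"
      using step[of "t - 1"] True by simp
    then show ?thesis
      by (auto simp: b_def F objective_def)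
  next
    case False
    then have "F (x t) \<noteq> \<infinity>"
      using that by auto
    with m[of "x t"] show ?thesis
      unfolding b_def by (cases "F (x t)") auto
  qed
  have "G \<longlonglongrightarrow> 0"
  proof -
    have "(\<lambda>k. a * G k) \<longlonglongrightarrow> 0"
    proof (rule windowed_descent_tendsto_0)
      \<comment> \<open>From \<open>q + 2\<close> on, windows contain only indices at least 2, so a
        possibly infinite \<open>F (x 1)\<close> is never met.\<close>
      fix k assume k: "q + 2 \<le> k"
      with desc[of k] obtain t where t: "t \<in> window q k" "F (x (k + 1)) + ereal (a * d k) \<le> F (x t)"
        by auto
      moreover have "2 \<le> t"
        using t(1) k by (auto simp: window_def)
      ultimately show "\<exists>t\<in>window q k. b (k + 1) + a * d k \<le> b t"
        using k by (auto simp: F_real)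
      show "m \<le> b k"
        using m[of "x k"] k by (simp add: F_real)
    next
      fix k t assume "q + 2 \<le> k" "t \<in> window q k"
      then show "a * G k \<le> a * d t"
        using d_\<phi>_le[of k t] G_eq[of k] \<open>0 < a\<close> by simp
    qed (use \<open>0 < a\<close> in \<open>auto simp: G_def d_def\<close>)
    from tendsto_mult_left[OF this, of "1 / a"] show ?thesis
      using \<open>0 < a\<close> by simp
  qed
  moreover have "ereal (Min (G ` {1..K})) \<le> ereal (2 * (real q + 1)) * c\<^sub>1 / ereal ((\<rho> - L) * real K)"
    if K: "1 \<le> K" for K
  proof -
    define \<mu> where "\<mu> = Min (G ` {1..K})"
    have \<mu>_le: "\<mu> \<le> d k" if "1 \<le> k" "k \<le> K" for k
    proof -
      have "\<mu> \<le> G k"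
        unfolding \<mu>_def using that by (intro Min_le) auto
      with G_eq[OF that(1)] d_\<phi>_le[OF that(1) mem_window_self[OF that(1)]] show ?thesis
        by simp
    qed
    have "\<mu> \<in> G ` {1..K}"
      unfolding \<mu>_def using K by (intro Min_in) auto
    then have "0 \<le> \<mu>"
      by (auto simp: G_def)
    \<comment> \<open>\<open>x 2\<close> is the first iterate whose value is known to be finite, so
      it bounds the infimum away from infinity.\<close>
    have "(INF u. F u) \<le> F (x 2)" "ereal m \<le> (INF u. F u)"
      using m by (auto intro: INF_lower INF_greatest)
    then obtain i where i: "(INF u. F u) = ereal i"
      using F_real[of 2] by (cases "INF u. F u") auto
    have "F (x 1) \<le> Max ((\<lambda>t. F (x t)) ` {1..q + 1})"
      by (intro Max_ge) auto
    then have c: "F (x 1) - ereal i \<le> c\<^sub>1"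
      unfolding assms(17) i by (intro ereal_minus_mono) auto
    have pos: "0 < (\<rho> - L) * real K"
      using \<open>0 < a\<close> K by (simp add: a_def)
    show ?thesis
    \<comment> \<open>An infinite starting value makes \<open>c\<^sub>1\<close>, and hence the
      right-hand side, infinite. Otherwise all values from index 1 on are real.\<close>
    proof (cases "F (x 1) = \<infinity>")
      case True
      then have "c\<^sub>1 = \<infinity>"
        using c by simp
      then show ?thesis
        using pos by simp
    next
      case False
      \<comment> \<open>The uniform margin is \<open>e = a * \<mu>\<close>; the factor 2 in the rate
        comes from \<open>a = (\<rho> - L) / 2\<close>.\<close>
      have "b (K + 1) + a * \<mu> * real K / (real q + 1) \<le> b 1"
      proof (rule windowed_descent_linear_bound)
        fix k assume k: "1 \<le> k" "k \<le> K"
        obtain t where t: "t \<in> window q k" "F (x (k + 1)) + ereal (a * d k) \<le> F (x t)"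
          using desc[OF k(1)] by blast
        moreover have "t = 1 \<or> 2 \<le> t"
          using t(1) by (auto simp: window_def)
        ultimately have "b (k + 1) + a * d k \<le> b t"
          using k False by (auto simp: F_real)
        with t(1) \<mu>_le[OF k] \<open>0 < a\<close> show "\<exists>t\<in>window q k. b (k + 1) + a * \<mu> \<le> b t"
          by (intro bexI[of _ t]) (auto intro: order_trans[OF add_left_mono[OF mult_left_mono]])
      qed (use \<open>0 < a\<close> \<open>0 \<le> \<mu>\<close> in auto)
      moreover have "i \<le> b (K + 1)"
        using INF_lower[of "x (K + 1)" UNIV F] i F_real[of "K + 1"] K by simp
      ultimately have "a * \<mu> * real K / (real q + 1) \<le> b 1 - i"
        by simp
      then have "a * \<mu> * real K \<le> (b 1 - i) * (real q + 1)"
        by (simp add: pos_divide_le_eq)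
      then have "\<mu> * ((\<rho> - L) * real K) \<le> 2 * (real q + 1) * (b 1 - i)"
        by (simp add: a_def field_simps)
      then have "\<mu> \<le> 2 * (real q + 1) * (b 1 - i) / ((\<rho> - L) * real K)"
        using pos by (simp only: pos_le_divide_eq)
      then have "ereal \<mu> \<le> ereal (2 * (real q + 1)) * ereal (b 1 - i) / ereal ((\<rho> - L) * real K)"
        using pos by (auto simp only: times_ereal.simps ereal_divide ereal_less_eq split: if_splits)
      also have "\<dots> \<le> ereal (2 * (real q + 1)) * c\<^sub>1 / ereal ((\<rho> - L) * real K)"
        using c pos F_real[of 1] False
        by (intro ereal_divide_right_mono ereal_mult_left_mono) auto
      finally show ?thesis
        unfolding \<mu>_def .
    qed
  qed
  ultimately show ?thesis
    unfolding G_def by blast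
qed

end
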